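(* Let $p$ be a prime and $m=2(p^2+p+1)$. Then there exists a subset $A\subseteq\mathbb{Z}_m$ such that $R_A(n)\le 4$ for all $n\in\mathbb{Z}_m$ and $$|\{n\in\mathbb{Z}_m:\ R_A(n)=4\}|=\frac{1}{2}m-1.$$
   Context: $\mathbb{Z}_m$ is the additive group of residue classes modulo $m$. For $A\subseteq\mathbb{Z}_m$ and $n\in\mathbb{Z}_m$, $R_A(n)$ denotes the number of ordered pairs $(a,a')\in A\times A$ with $a+a'=n$. *)

theory Defs
  imports Complex_Main "HOL-Algebra.Elementary_Groups" "HOL-Computational_Algebra.Primes"
begin

text \<open>The group $\mathbb{Z}_m$ is the library's \<^const>\<open>integer_mod_group\<close>. It is written
  multiplicatively, as are all groups of HOL-Algebra, so its operation \<open>\<otimes>\<close> is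
  addition modulo \<open>m\<close> on the carrier \<open>{0..<int m}\<close> (for \<open>m > 0\<close>).\<close>

definition rep_count :: "('a, 'b) monoid_scheme \<Rightarrow> 'a set \<Rightarrow> 'a \<Rightarrow> nat" where
  "rep_count G A n = card {(a, a'). a \<in> A \<and> a' \<in> A \<and> a \<otimes>\<^bsub>G\<^esub> a' = n}"

end

theory Submission
  imports "HOL-Algebra.Polynomial_Divisibility"
    "HOL-Number_Theory.Residues" Defs
begin

text \<open>Let $q = p^2 + p + 1$. By Singer's theorem there is a Sidon set $D \subseteq \mathbb{Z}_q$ with
  $p + 1$ elements. Take for $A$ its full preimage under $\mathbb{Z}_{2q} \to \mathbb{Z}_q$, so
  that $R_A(n) = 2 R_D(n \bmod q)$. The Sidon property gives $R_D \le 2$, with equality exactly at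
  the sums of two distinct elements of $D$; there are $\binom{p+1}{2}$ of these, each with two
  preimages, which makes $p(p+1) = q - 1 = m/2 - 1$ values in total.

  For Singer's theorem, let $\theta$ generate the field of order $p^3$ over $\mathbb{F}_p$. Then $D$
  consists of the discrete logarithms modulo $q$ of $1$ and of all $\theta + a$ with
  $a \in \mathbb{F}_p$. Indeed the $q$-th powers of a primitive element lie in $\mathbb{F}_p$,
  and $1, \theta, \theta^2$ are independent over $\mathbb{F}_p$, so a coincidence of sums of logarithms
  is an identity between products of two linear (or constant) polynomials up to a scalar.\<close>

section \<open>Irreducible cubics over a finite field\<close>

text \<open>The triple $(r, b, c)$ is mapped to the coefficients of $(x - r)(x^2 + b x + c)$. Were every
  cubic to have a root, this map would be onto, hence injective; but $x (x - 1) x$ has two such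
  factorizations.\<close>

lemma (in field) exists_cubic_without_root:
  assumes "finite (carrier R)"
  shows "\<exists>a\<in>carrier R. \<exists>b\<in>carrier R. \<exists>c\<in>carrier R. \<forall>r\<in>carrier R.
    r \<otimes> r \<otimes> r \<oplus> a \<otimes> (r \<otimes> r) \<oplus> b \<otimes> r \<oplus> c \<noteq> \<zero>"
proof (rule ccontr)
  assume contra: "\<not> ?thesis"
  define T where "T = carrier R \<times> carrier R \<times> carrier R"
  define f where "f = (\<lambda>(r, b, c). (b \<ominus> r, c \<ominus> r \<otimes> b, \<ominus> (r \<otimes> c)))"
  have "T \<subseteq> f ` T"
  proof clarify
    fix a b c assume "(a, b, c) \<in> T"
    hence abc: "a \<in> carrier R" "b \<in> carrier R" "c \<in> carrier R" by (auto simp: T_def)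
    then obtain r where r: "r \<in> carrier R"
      and root: "r \<otimes> r \<otimes> r \<oplus> a \<otimes> (r \<otimes> r) \<oplus> b \<otimes> r \<oplus> c = \<zero>"
      using contra by blast
    \<comment> \<open>Horner's scheme for division by \<open>x - r\<close>: the quotient is
      \<open>x^2 + (a + r) x + (b + r (a + r))\<close>, and its two lower coefficients complete the
      preimage of the triple.\<close>
    have "r \<otimes> (b \<oplus> r \<otimes> (a \<oplus> r)) \<oplus> c = \<zero>"
      using abc r root by (simp add: r_distr a_ac m_ac)
    hence "\<ominus> (r \<otimes> (b \<oplus> r \<otimes> (a \<oplus> r))) = c"
      using abc r by (metis a_comm add.m_closed m_closed minus_equality)
    moreover have "(a \<oplus> r) \<ominus> r = a" "(b \<oplus> r \<otimes> (a \<oplus> r)) \<ominus> r \<otimes> (a \<oplus> r) = b"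
      using abc r by algebra+
    ultimately have "f (r, a \<oplus> r, b \<oplus> r \<otimes> (a \<oplus> r)) = (a, b, c)"
      by (simp add: f_def)
    moreover have "(r, a \<oplus> r, b \<oplus> r \<otimes> (a \<oplus> r)) \<in> T"
      using abc r by (simp add: T_def)
    ultimately show "(a, b, c) \<in> f ` T" by (metis image_eqI)
  qed
  hence "inj_on f T"
    using assms by (intro finite_surj_inj) (auto simp: T_def)
  moreover have "f (\<zero>, \<ominus> \<one>, \<zero>) = f (\<one>, \<zero>, \<zero>)"
    by (simp add: f_def minus_eq)
  ultimately have "(\<zero>, \<ominus> \<one>, \<zero>) = (\<one>, \<zero>, \<zero>)"
    by (rule inj_onD) (simp_all add: T_def)
  thus False by simp
qed

text \<open>The degrees of two factors add up to 3, so two non-units would include one of degree 1,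
  which has a root. Coefficient lists start with the leading coefficient.\<close>

lemma (in field) pirreducible_cubic:
  assumes [simp]: "a \<in> carrier R" "b \<in> carrier R" "c \<in> carrier R"
    and no_root: "\<And>r. r \<in> carrier R \<Longrightarrow>
      r \<otimes> r \<otimes> r \<oplus> a \<otimes> (r \<otimes> r) \<oplus> b \<otimes> r \<oplus> c \<noteq> \<zero>"
  shows "[\<one>, a, b, c] \<in> carrier (poly_ring R)" "pirreducible (carrier R) [\<one>, a, b, c]"
proof -
  let ?P = "[\<one>, a, b, c]"
  show P: "?P \<in> carrier (poly_ring R)"
    by (simp add: univ_poly_carrier[symmetric] polynomial_def)
  have no_linear: False
    if "u \<in> carrier (poly_ring R)" "u pdivides ?P" "degree u = 1" for u
  proof -
    let ?r = "\<ominus> (inv (lead_coeff u) \<otimes> (const_term u))"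
    have r: "?r \<in> carrier R"
      using degree_one_root(2)[OF carrier_is_subfield that(1,3)] by simp
    have "eval u ?r = \<zero>"
      using degree_one_root(1)[OF carrier_is_subfield that(1,3)] .
    hence "eval ?P ?r = \<zero>"
      using pdivides_imp_root_sharing[OF that(1,2) r] by simp
    moreover have "eval ?P ?r = ?r \<otimes> ?r \<otimes> ?r \<oplus> a \<otimes> (?r \<otimes> ?r) \<oplus> b \<otimes> ?r \<oplus> c"
      using r by (simp add: numeral_3_eq_3 numeral_2_eq_2 a_assoc)
    ultimately show False using no_root[OF r] by simp
  qed
  interpret UP: domain "poly_ring R"
    using univ_poly_is_domain[OF carrier_is_subring] .
  show "pirreducible (carrier R) ?P"
  proof (rule pirreducibleI[OF carrier_is_subring P])
    show "?P \<notin> Units (poly_ring R)"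
      by (simp add: univ_poly_units'[OF carrier_is_subfield])
    fix u v assume u: "u \<in> carrier (poly_ring R)" and v: "v \<in> carrier (poly_ring R)"
      and uv: "?P = u \<otimes>\<^bsub>poly_ring R\<^esub> v"
    have nz: "u \<noteq> []" "v \<noteq> []"
      using uv u v UP.l_null UP.r_null by (auto simp: univ_poly_zero)
    have "degree ?P = degree u + degree v"
      using poly_mult_degree_eq[OF carrier_is_subring, of u v] u v nz uv
      by (simp add: univ_poly_carrier univ_poly_mult)
    hence "degree u = 0 \<or> degree v = 0 \<or> degree u = 1 \<or> degree v = 1"
      by auto
    moreover have "u pdivides ?P" "v pdivides ?P"
      using u v uv UP.m_comm by (auto simp: pdivides_def factor_def)
    ultimately show "u \<in> Units (poly_ring R) \<or> v \<in> Units (poly_ring R)"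
      using no_linear u v nz univ_poly_units'[OF carrier_is_subfield] by blast
  qed simp
qed

section \<open>The power basis of a simple extension\<close>

text \<open>The remainders on division by \<open>p\<close> are the span of the powers of
  \<open>X\<close> below \<open>degree p\<close>. The quotient map \<open>h\<close> is injective on
  them and they already cover the quotient, so the basis of powers of \<open>X\<close> is carried to
  a basis of powers of \<open>h X\<close>.\<close>

lemma (in domain) rupture_exp_base:
  assumes "subfield K R" and "p \<in> carrier (K[X])" and "pirreducible K p"
  defines "h \<equiv> rupture_surj K p"
  shows "ring.independent (Rupt K p) (h ` poly_of_const ` K) (ring.exp_base (Rupt K p) (h X) (degree p))"
    and "ring.Span (Rupt K p) (h ` poly_of_const ` K) (ring.exp_base (Rupt K p) (h X) (degree p))
           = carrier (Rupt K p)"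
proof -
  note subring = subfieldE(1)[OF assms(1)]
  interpret UP: domain "K[X]" using univ_poly_is_domain[OF subring] .
  interpret Hom: ring_hom_ring "K[X]" "Rupt K p" h
    unfolding h_def using rupture_surj_hom(2)[OF subring assms(2)] .
  have ne: "p \<noteq> []" using pirreducibleE(1)[OF subring assms(2,3)] .
  have Xc: "X \<in> carrier (K[X])" using var_closed(1)[OF subring] .
  have base: "map h (UP.exp_base X n) = Hom.S.exp_base (h X) n" for n
    using Hom.hom_nat_pow[OF Xc] by (simp add: UP.exp_base_def Hom.S.exp_base_def)
  have span: "UP.Span (poly_of_const ` K) (UP.exp_base X (degree p))
      = (\<lambda>q. q pmod p) ` carrier (K[X])"
    using Span_var_pow_base[OF assms(1)] pmod_image_characterization[OF assms(1,2) ne] by simp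
  have deg: "degree p \<ge> 1" using pirreducible_degree[OF assms(1-3)] .
  have one_ne: "\<one>\<^bsub>Rupt K p\<^esub> \<noteq> \<zero>\<^bsub>Rupt K p\<^esub>"
    using rupture_one_not_zero[OF assms(1,2)] deg by simp
  have sub: "subfield (poly_of_const ` K) (K[X])"
    using univ_poly_subfield_of_consts[OF assms(1)] .
  have "inj_on h (UP.Span (poly_of_const ` K) (UP.exp_base X (degree p)))"
    unfolding span h_def using rupture_surj_inj_on[OF assms(1,2)] .
  from Hom.inj_hom_preserves_independent[OF sub one_ne this var_pow_base_independent[OF assms(1)]]
  show "Hom.S.independent (h ` poly_of_const ` K) (Hom.S.exp_base (h X) (degree p))"
    unfolding base .
  have "Hom.S.Span (h ` poly_of_const ` K) (map h (UP.exp_base X (degree p))) = carrier (Rupt K p)"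
    unfolding Hom.Span_hom[OF subfieldE(3)[OF sub] UP.exp_base_closed[OF Xc]] span
    unfolding h_def by (rule rupture_carrier_as_pmod_image[OF assms(1,2)])
  thus "Hom.S.Span (h ` poly_of_const ` K) (Hom.S.exp_base (h X) (degree p)) = carrier (Rupt K p)"
    unfolding base .
qed

section \<open>Sidon sets modulo q and representation counts\<close>

text \<open>Unordered pairs are compared as sets and may be degenerate: a double
  \<open>a + a\<close> is then congruent to no other sum of two elements.\<close>

definition sidon_mod :: "int \<Rightarrow> int set \<Rightarrow> bool" where
  "sidon_mod n D \<longleftrightarrow>
    (\<forall>a\<in>D. \<forall>b\<in>D. \<forall>c\<in>D. \<forall>d\<in>D. [a + b = c + d] (mod n) \<longrightarrow> {a, b} = {c, d})"

lemma sidon_modD: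
  assumes "sidon_mod n D" "a \<in> D" "b \<in> D" "c \<in> D" "d \<in> D" "(a + b) mod n = (c + d) mod n"
  shows "{a, b} = {c, d}"
  using assms unfolding sidon_mod_def cong_def by blast

lemma card_periodic_double:
  fixes q :: int
  assumes "q > 0"
  shows "card {n \<in> {0..<2 * q}. P (n mod q)} = 2 * card {n \<in> {0..<q}. P n}"
proof -
  let ?S = "{n \<in> {0..<q}. P n}"
  have "n \<in> ?S \<union> (+) q ` ?S" if "0 \<le> n" "n < 2 * q" "P (n mod q)" for n
  proof (cases "n < q")
    case False
    have "n mod q = (n - q) mod q" by simp
    also have "\<dots> = n - q" using that False by (intro mod_pos_pos_trivial) auto
    finally have "n = q + (n - q)" "n - q \<in> ?S" using that False by auto
    thus ?thesis by blast
  qed (use that in auto)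
  hence "{n \<in> {0..<2 * q}. P (n mod q)} = ?S \<union> (+) q ` ?S"
    using assms by fastforce
  moreover have "?S \<inter> (+) q ` ?S = {}" "finite ?S"
    by (auto intro: finite_subset[of _ "{0..<q}"])
  ultimately show ?thesis
    by (simp add: card_Un_disjoint card_image)
qed

text \<open>For \<open>D\<close> inside \<open>{0..<q}\<close> this is the count of ordered
  representations modulo \<open>q\<close>: the first summand \<open>d\<close> determines the
  second.\<close>

definition rep_mod :: "int \<Rightarrow> int set \<Rightarrow> int \<Rightarrow> nat" where
  "rep_mod q D n = card {d \<in> D. (n - d) mod q \<in> D}"

text \<open>The partner of \<open>a\<close> is \<open>(n - a) mod (2 * q)\<close>, and it lies in
  the preimage of \<open>D\<close> exactly if its residue modulo \<open>q\<close> lies in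
  \<open>D\<close>. The condition thus depends only on \<open>a mod q\<close>, and each residue has
  two lifts.\<close>

lemma rep_count_lift:
  assumes "q > 0" "D \<subseteq> {0..<int q}" "n \<in> {0..<2 * int q}"
  shows "rep_count (integer_mod_group (2 * q)) {a \<in> {0..<2 * int q}. a mod int q \<in> D} n
    = 2 * rep_mod (int q) D (n mod int q)"
proof -
  define A where "A = {a \<in> {0..<2 * int q}. a mod int q \<in> D}"
  let ?B = "{a \<in> A. (n - a) mod int q \<in> D}"
  have mm: "x mod (2 * int q) mod int q = x mod int q" for x
    by (simp add: mod_mod_cancel)
  have "{(a, a'). a \<in> A \<and> a' \<in> A \<and> (a + a') mod (2 * int q) = n}
      = (\<lambda>a. (a, (n - a) mod (2 * int q))) ` ?B"
  proof (intro equalityI subsetI)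
    fix x assume "x \<in> {(a, a'). a \<in> A \<and> a' \<in> A \<and> (a + a') mod (2 * int q) = n}"
    then obtain a a' where x: "x = (a, a')" "a \<in> A" "a' \<in> A" "(a + a') mod (2 * int q) = n"
      by auto
    have "(n - a) mod (2 * int q) = a' mod (2 * int q)"
      unfolding x(4)[symmetric] by (simp add: mod_simps)
    also have "\<dots> = a'" using x(3) by (simp add: A_def)
    finally have a': "(n - a) mod (2 * int q) = a'" .
    hence "(n - a) mod int q = a' mod int q" using mm by metis
    thus "x \<in> (\<lambda>a. (a, (n - a) mod (2 * int q))) ` ?B"
      using x a' by (auto simp: A_def)
  next
    fix x assume "x \<in> (\<lambda>a. (a, (n - a) mod (2 * int q))) ` ?B"
    thus "x \<in> {(a, a'). a \<in> A \<and> a' \<in> A \<and> (a + a') mod (2 * int q) = n}"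
      using assms mm by (auto simp: A_def mod_simps)
  qed
  hence "rep_count (integer_mod_group (2 * q)) A n = card ?B"
    unfolding rep_count_def by (simp add: card_image inj_on_def)
  also have "?B = {a \<in> {0..<2 * int q}. a mod int q \<in> D \<and> (n mod int q - a mod int q) mod int q \<in> D}"
    by (auto simp: A_def mod_simps)
  also have "card \<dots> = 2 * card {d \<in> {0..<int q}. d \<in> D \<and> (n mod int q - d) mod int q \<in> D}"
    using card_periodic_double[of "int q" "\<lambda>d. d \<in> D \<and> (n mod int q - d) mod int q \<in> D"] assms by simp
  also have "{d \<in> {0..<int q}. d \<in> D \<and> (n mod int q - d) mod int q \<in> D}
      = {d \<in> D. (n mod int q - d) mod int q \<in> D}" using assms by auto
  finally show ?thesis by (simp add: A_def rep_mod_def)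
qed

context
  fixes q :: int and D :: "int set"
  assumes D: "D \<subseteq> {0..<q}" and sidon: "sidon_mod q D"
begin

text \<open>By the Sidon property, every representation of \<open>n\<close> uses the same unordered
  pair as the given one.\<close>

lemma rep_set_subset:
  assumes "d \<in> D" "(n - d) mod q \<in> D"
  shows "{e \<in> D. (n - e) mod q \<in> D} = {d, (n - d) mod q}"
proof -
  have "e \<in> {d, (n - d) mod q}" if e: "e \<in> D" "(n - e) mod q \<in> D" for e
  proof -
    have "(e + (n - e) mod q) mod q = (d + (n - d) mod q) mod q"
      by (simp add: mod_add_right_eq)
    from sidon_modD[OF sidon e assms this] show ?thesis by blast
  qed
  \<comment> \<open>The partner of \<open>d\<close> has \<open>d\<close> as its own partner, so it
    belongs to the set as well.\<close>
  moreover have "(n - (n - d) mod q) mod q = d"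
  proof -
    have "(n - (n - d) mod q) mod q = d mod q" by (simp add: mod_diff_right_eq)
    thus ?thesis using assms(1) D by auto
  qed
  ultimately show ?thesis using assms by (intro equalityI subsetI) (auto simp only: mem_Collect_eq insert_iff empty_iff)
qed

lemma rep_mod_le_2: "rep_mod q D n \<le> 2"
proof (cases "\<exists>d\<in>D. (n - d) mod q \<in> D")
  case True
  then obtain d where "d \<in> D" "(n - d) mod q \<in> D" by auto
  from rep_set_subset[OF this] show ?thesis
    by (simp add: rep_mod_def card_insert_if)
next
  case False
  hence "{d \<in> D. (n - d) mod q \<in> D} = {}" by auto
  thus ?thesis unfolding rep_mod_def by (simp only: card.empty)
qed

text \<open>The values counted are the sums of the 2-element subsets of \<open>D\<close>, and the
  Sidon property makes the map from subsets to sums injective. A double \<open>d + d\<close> is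
  represented only once.\<close>

lemma card_rep_mod_eq_2:
  "card {n \<in> {0..<q}. rep_mod q D n = 2} = card D choose 2"
proof -
  have fin: "finite D" using finite_subset[OF D] by simp
  let ?P = "{T. T \<subseteq> D \<and> card T = 2}"
  let ?s = "\<lambda>T::int set. (\<Sum>x\<in>T. x) mod q"
  have two: "\<exists>a b. a \<noteq> b \<and> a \<in> D \<and> b \<in> D \<and> T = {a, b} \<and> ?s T = (a + b) mod q"
    if T: "T \<in> ?P" for T
  proof -
    obtain a b where "T = {a, b}" "a \<noteq> b" using T by (auto simp only: card_2_iff mem_Collect_eq)
    thus ?thesis using T by (intro exI[of _ a] exI[of _ b]) simp
  qed
  have inj: "inj_on ?s ?P"
  proof (rule inj_onI)
    fix S T assume ST: "S \<in> ?P" "T \<in> ?P" "?s S = ?s T"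
    obtain a b where ab: "a \<in> D" "b \<in> D" "S = {a, b}" "?s S = (a + b) mod q"
      using two[OF ST(1)] by blast
    obtain c d where cd: "c \<in> D" "d \<in> D" "T = {c, d}" "?s T = (c + d) mod q"
      using two[OF ST(2)] by blast
    show "S = T"
      using sidon_modD[OF sidon ab(1,2) cd(1,2)] ST(3) ab(3,4) cd(3,4) by simp
  qed
  have img: "?s ` ?P = {n \<in> {0..<q}. rep_mod q D n = 2}"
  proof (intro equalityI subsetI)
    fix n assume "n \<in> ?s ` ?P"
    then obtain a b where ab: "a \<noteq> b" "a \<in> D" "b \<in> D" "n = (a + b) mod q"
      using two by blast
    have "(n - a) mod q = b mod q"
      unfolding ab(4) by (simp add: mod_diff_left_eq)
    also have "\<dots> = b" using ab(3) D by auto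
    finally have "(n - a) mod q = b" .
    hence "rep_mod q D n = 2"
      using rep_set_subset[of a n] ab by (simp add: rep_mod_def)
    moreover have "q > 0" using ab D by auto
    ultimately show "n \<in> {n \<in> {0..<q}. rep_mod q D n = 2}" using ab by simp
  next
    fix n assume n: "n \<in> {n \<in> {0..<q}. rep_mod q D n = 2}"
    hence "{e \<in> D. (n - e) mod q \<in> D} \<noteq> {}"
      unfolding rep_mod_def by force
    then obtain d where d: "d \<in> D" "(n - d) mod q \<in> D" by auto
    let ?T = "{d, (n - d) mod q}"
    have card: "card ?T = 2"
      using n rep_set_subset[OF d] by (simp add: rep_mod_def)
    hence "d \<noteq> (n - d) mod q" by auto
    hence "?s ?T = (d + (n - d) mod q) mod q" by simp
    also have "\<dots> = n mod q" by (simp add: mod_add_right_eq)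
    also have "\<dots> = n" using n by simp
    finally have "n = ?s ?T" ..
    thus "n \<in> ?s ` ?P" using d card by blast
  qed
  show ?thesis
    using card_image[OF inj] n_subsets[OF fin, of 2] unfolding img by simp
qed

end

section \<open>Counting in finite extensions and recognizing a subfield\<close>

lemma (in ring) card_Span_independent:
  assumes "subfield K R" "finite K" "independent K Us"
  shows "card (Span K Us) = card K ^ length Us"
proof -
  let ?L = "{Ks. set Ks \<subseteq> K \<and> length Ks = length Us}"
  have Us: "set Us \<subseteq> carrier R"
    using independent_in_carrier[OF assms(3)] .
  have "Span K Us = (\<lambda>Ks. combine Ks Us) ` ?L"
    using Span_eq_combine_set_length_version[OF assms(1) Us] by (auto simp del: Span.simps)
  moreover have "inj_on (\<lambda>Ks. combine Ks Us) ?L"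
  proof (rule inj_onI)
    fix Ks Ls assume *: "Ks \<in> ?L" "Ls \<in> ?L" "combine Ks Us = combine Ls Us"
    hence "combine Ks Us \<in> Span K Us"
      using Span_eq_combine_set_length_version[OF assms(1) Us] by (auto simp del: Span.simps)
    from unique_decomposition[OF assms(1,3) this] * show "Ks = Ls" by auto
  qed
  ultimately show ?thesis
    using card_lists_length_eq[OF assms(2), of "length Us"] by (simp add: card_image del: Span.simps)
qed

text \<open>This is Lagrange's theorem in the multiplicative group of \<open>F\<close>.\<close>

lemma (in field) pow_card_subfield_eq_one:
  assumes "subfield F R" "finite F" "x \<in> F - {\<zero>}"
  shows "x [^] (card F - 1) = \<one>"
proof -
  interpret F: field "R\<lparr>carrier := F\<rparr>" using subfield_iff(2)[OF assms(1)] .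
  interpret G: group "Multiplicative_Group.mult_of (R\<lparr>carrier := F\<rparr>)" by (rule F.field_mult_group)
  have "card (F - {\<zero>}) = card F - 1"
    using assms(2) subringE(2)[OF subfieldE(1)[OF assms(1)]] by simp
  moreover have "x [^] card (F - {\<zero>}) = \<one>"
    using G.pow_order_eq_1[of x] assms(3)
    by (simp add: order_def Multiplicative_Group.nat_pow_mult_of nat_pow_consistent[symmetric])
  ultimately show ?thesis by simp
qed

text \<open>The equation has at most \<open>card F - 1\<close> solutions in the field, and the
  nonzero elements of \<open>F\<close> already supply that many.\<close>

lemma (in field) mem_subfield_if_pow_eq_one:
  assumes "finite (carrier R)" "subfield F R" "x \<in> carrier R" "x [^] (card F - 1) = \<one>"
  shows "x \<in> F"
proof -
  let ?Z = "{y \<in> carrier R. y [^] (card F - 1) = \<one>}"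
  have F: "F \<subseteq> carrier R" "\<zero> \<in> F" "\<one> \<in> F"
    using subfieldE(3)[OF assms(2)] subringE(2,3)[OF subfieldE(1)[OF assms(2)]] by auto
  have fin: "finite F" using F(1) assms(1) finite_subset by blast
  have card: "card (F - {\<zero>}) = card F - 1" using F fin by simp
  \<comment> \<open>The root bound requires a positive exponent; zero and one are distinct elements
    of \<open>F\<close>.\<close>
  moreover have "card (F - {\<zero>}) \<noteq> 0"
    using F fin card_mono[of F "{\<zero>, \<one>}"] by simp
  ultimately have "card ?Z \<le> card (F - {\<zero>})"
    using num_roots_le_deg[OF assms(1), of "card F - 1"] by simp
  moreover have "F - {\<zero>} \<subseteq> ?Z"
    using pow_card_subfield_eq_one[OF assms(2) fin] F by auto
  ultimately have "F - {\<zero>} = ?Z"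
    using assms(1) by (intro card_seteq) auto
  thus ?thesis using assms(3,4) by blast
qed

section \<open>Singer's construction in a cubic extension\<close>

context field
begin

text \<open>The list \<open>exp_base \<theta> 3\<close> consists of the square of
  \<open>\<theta>\<close>, then \<open>\<theta>\<close>, then one, and coordinates with respect to
  an independent list are unique.\<close>

lemma quadratic_coeffs_eq:
  assumes F: "subfield F R" and \<theta>: "\<theta> \<in> carrier R"
    and indep: "independent F (exp_base \<theta> 3)"
    and abc: "a \<in> F" "b \<in> F" "c \<in> F" "a' \<in> F" "b' \<in> F" "c' \<in> F"
    and eq: "a \<otimes> (\<theta> \<otimes> \<theta>) \<oplus> b \<otimes> \<theta> \<oplus> c = a' \<otimes> (\<theta> \<otimes> \<theta>) \<oplus> b' \<otimes> \<theta> \<oplus> c'"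
  shows "a = a'" "b = b'" "c = c'"
proof -
  have FR: "F \<subseteq> carrier R" using subfieldE(3)[OF F] .
  have [simp]: "a \<in> carrier R" "b \<in> carrier R" "c \<in> carrier R"
    "a' \<in> carrier R" "b' \<in> carrier R" "c' \<in> carrier R" using FR abc by auto
  have base: "exp_base \<theta> 3 = [\<theta> \<otimes> \<theta>, \<theta>, \<one>]"
    using \<theta> by (simp add: exp_base_def numeral_3_eq_3)
  have comb: "combine [x, y, z] (exp_base \<theta> 3) = x \<otimes> (\<theta> \<otimes> \<theta>) \<oplus> y \<otimes> \<theta> \<oplus> z"
    if "x \<in> carrier R" "y \<in> carrier R" "z \<in> carrier R" for x y z
    using that \<theta> by (simp add: base a_assoc)
  have "combine [a, b, c] (exp_base \<theta> 3) \<in> Span F (exp_base \<theta> 3)"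
    using Span_eq_combine_set[OF F exp_base_closed[OF \<theta>], of 3] abc
    by (auto simp del: Span.simps combine.simps intro!: exI[of _ "[a, b, c]"])
  from unique_decomposition[OF F indep this]
  have uniq: "Ks = Ls" if "set Ks \<subseteq> F" "set Ls \<subseteq> F" "length Ks = 3" "length Ls = 3"
    "combine Ks (exp_base \<theta> 3) = combine [a, b, c] (exp_base \<theta> 3)"
    "combine Ls (exp_base \<theta> 3) = combine [a, b, c] (exp_base \<theta> 3)" for Ks Ls
    using that by (metis (no_types) base length_Cons list.size(3) numeral_3_eq_3)
  have "combine [a', b', c'] (exp_base \<theta> 3) = combine [a, b, c] (exp_base \<theta> 3)"
    using eq comb[of a b c] comb[of a' b' c'] by simp
  hence "[a, b, c] = [a', b', c']"
    using abc by (intro uniq) auto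
  thus "a = a'" "b = b'" "c = c'" by simp_all
qed

text \<open>The set \<open>V\<close> represents the nonzero elements of the plane spanned by one and
  \<open>\<theta>\<close> up to scalars from \<open>F\<close>. Comparing coordinates turns the
  equation into an identity of polynomials of degree at most 2. All factors have leading coefficient
  one, so \<open>k\<close> must be one, and unique factorization remains.\<close>

lemma product_of_linear_factors_unique:
  assumes F: "subfield F R" and \<theta>: "\<theta> \<in> carrier R"
    and indep: "independent F (exp_base \<theta> 3)"
    and V: "V = insert \<one> ((\<lambda>a. \<theta> \<oplus> a) ` F)"
    and uvwz: "u \<in> V" "v \<in> V" "w \<in> V" "z \<in> V" and k: "k \<in> F" and k0: "k \<noteq> \<zero>"
    and eq: "u \<otimes> v = k \<otimes> (w \<otimes> z)"
  shows "{u, v} = {w, z}"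
proof -
  have FR: "F \<subseteq> carrier R" using subfieldE(3)[OF F] .
  note subring = subringE[OF subfieldE(1)[OF F]]
  have [simp]: "\<zero> \<in> F" "\<one> \<in> F" and kR: "k \<in> carrier R" using subring FR k by auto
  \<comment> \<open>Here \<open>s\<close> is the coefficient of \<open>\<theta>\<close>;
    \<open>s = \<zero>\<close> encodes the single constant element of \<open>V\<close>, hence the
    forced \<open>a = \<one>\<close>.\<close>
  have form: "\<exists>s a. s \<in> {\<zero>, \<one>} \<and> a \<in> F \<and> (s = \<zero> \<longrightarrow> a = \<one>) \<and> x = s \<otimes> \<theta> \<oplus> a"
    if x: "x \<in> V" for x
  proof (cases "x = \<one>")
    case True
    thus ?thesis using \<theta> by (intro exI[of _ \<zero>] exI[of _ \<one>]) auto
  next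
    case False
    then obtain a where "a \<in> F" "x = \<theta> \<oplus> a" using x unfolding V by blast
    thus ?thesis using \<theta> by (intro exI[of _ \<one>] exI[of _ a]) auto
  qed
  obtain s1 a1 where 1: "s1 \<in> {\<zero>, \<one>}" "a1 \<in> F" "s1 = \<zero> \<longrightarrow> a1 = \<one>" "u = s1 \<otimes> \<theta> \<oplus> a1"
    using form[OF uvwz(1)] by blast
  obtain s2 a2 where 2: "s2 \<in> {\<zero>, \<one>}" "a2 \<in> F" "s2 = \<zero> \<longrightarrow> a2 = \<one>" "v = s2 \<otimes> \<theta> \<oplus> a2"
    using form[OF uvwz(2)] by blast
  obtain s3 a3 where 3: "s3 \<in> {\<zero>, \<one>}" "a3 \<in> F" "s3 = \<zero> \<longrightarrow> a3 = \<one>" "w = s3 \<otimes> \<theta> \<oplus> a3"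
    using form[OF uvwz(3)] by blast
  obtain s4 a4 where 4: "s4 \<in> {\<zero>, \<one>}" "a4 \<in> F" "s4 = \<zero> \<longrightarrow> a4 = \<one>" "z = s4 \<otimes> \<theta> \<oplus> a4"
    using form[OF uvwz(4)] by blast
  have sF: "s1 \<in> F" "s2 \<in> F" "s3 \<in> F" "s4 \<in> F" using 1(1) 2(1) 3(1) 4(1) by auto
  have R: "s1 \<in> carrier R" "s2 \<in> carrier R" "s3 \<in> carrier R" "s4 \<in> carrier R"
    "a1 \<in> carrier R" "a2 \<in> carrier R" "a3 \<in> carrier R" "a4 \<in> carrier R"
    using sF 1(2) 2(2) 3(2) 4(2) FR by auto
  have "(s1 \<otimes> s2) \<otimes> (\<theta> \<otimes> \<theta>) \<oplus> (s1 \<otimes> a2 \<oplus> s2 \<otimes> a1) \<otimes> \<theta> \<oplus> a1 \<otimes> a2 = u \<otimes> v"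
    unfolding 1(4) 2(4) using R \<theta> by algebra
  also have "\<dots> = (k \<otimes> (s3 \<otimes> s4)) \<otimes> (\<theta> \<otimes> \<theta>) \<oplus> (k \<otimes> (s3 \<otimes> a4 \<oplus> s4 \<otimes> a3)) \<otimes> \<theta> \<oplus> k \<otimes> (a3 \<otimes> a4)"
    unfolding eq 3(4) 4(4) using R \<theta> kR by algebra
  finally have quad: "(s1 \<otimes> s2) \<otimes> (\<theta> \<otimes> \<theta>) \<oplus> (s1 \<otimes> a2 \<oplus> s2 \<otimes> a1) \<otimes> \<theta> \<oplus> a1 \<otimes> a2
      = (k \<otimes> (s3 \<otimes> s4)) \<otimes> (\<theta> \<otimes> \<theta>) \<oplus> (k \<otimes> (s3 \<otimes> a4 \<oplus> s4 \<otimes> a3)) \<otimes> \<theta> \<oplus> k \<otimes> (a3 \<otimes> a4)" .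
  note closed = subring(6,7)
  have mem: "s1 \<otimes> s2 \<in> F" "s1 \<otimes> a2 \<oplus> s2 \<otimes> a1 \<in> F" "a1 \<otimes> a2 \<in> F"
    "k \<otimes> (s3 \<otimes> s4) \<in> F" "k \<otimes> (s3 \<otimes> a4 \<oplus> s4 \<otimes> a3) \<in> F" "k \<otimes> (a3 \<otimes> a4) \<in> F"
    by (intro closed sF k 1(2) 2(2) 3(2) 4(2))+
  note coeffs = quadratic_coeffs_eq[OF F \<theta> indep mem quad]
  have monic: "{a1, a2} = {a3, a4}" if sum: "a2 \<oplus> a1 = a4 \<oplus> a3" and prod: "a1 \<otimes> a2 = a3 \<otimes> a4"
  proof -
    \<comment> \<open>Vieta: two pairs with equal sum and product are the roots of the same
      quadratic, so \<open>a1\<close> is a root of \<open>(x - a3) (x - a4)\<close>.\<close>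
    have "(a1 \<ominus> a3) \<otimes> (a1 \<ominus> a4) = a1 \<otimes> (a2 \<oplus> a1) \<ominus> a1 \<otimes> (a4 \<oplus> a3) \<oplus> (a3 \<otimes> a4 \<ominus> a1 \<otimes> a2)"
      using R by algebra
    also have "\<dots> = \<zero>"
      unfolding sum prod using R by algebra
    finally have "a1 = a3 \<or> a1 = a4"
      using R by (simp add: integral_iff)
    thus ?thesis
    proof
      assume "a1 = a3"
      hence "a2 = a4" using sum R by simp
      thus ?thesis using \<open>a1 = a3\<close> by simp
    next
      assume "a1 = a4"
      hence "a2 = a3" using sum R by (metis a_comm add.r_cancel)
      thus ?thesis using \<open>a1 = a4\<close> by auto
    qed
  qed
  have "{(s1, a1), (s2, a2)} = {(s3, a3), (s4, a4)}"
  \<comment> \<open>Both sides must contain equally many linear factors: otherwise the coefficients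
    contradict \<open>k \<noteq> \<zero>\<close> or equate one with zero. These cases and the one
    with four constants are left to the closing \<open>simp\<close>.\<close>
  proof (cases "s1 = \<one>"; cases "s2 = \<one>"; cases "s3 = \<one>"; cases "s4 = \<one>")
    assume s: "s1 = \<one>" "s2 = \<one>" "s3 = \<one>" "s4 = \<one>"
    hence "k = \<one>" using coeffs(1) kR by simp
    hence "{a1, a2} = {a3, a4}" using coeffs(2,3) R s by (intro monic) simp_all
    from arg_cong[OF this, of "image (Pair \<one>)"] show ?thesis using s by simp
  next
    assume s: "s1 = \<one>" "s2 \<noteq> \<one>" "s3 = \<one>" "s4 \<noteq> \<one>"
    hence s0: "s2 = \<zero>" "s4 = \<zero>" and a1: "a2 = \<one>" "a4 = \<one>"
      using 2(1,3) 4(1,3) by auto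
    have "k = \<one>" using coeffs(2) R kR s(1,3) s0 a1 by simp
    hence "a1 = a3" using coeffs(3) R a1 by simp
    thus ?thesis using s(1,3) s0 a1 by auto
  next
    assume s: "s1 = \<one>" "s2 \<noteq> \<one>" "s3 \<noteq> \<one>" "s4 = \<one>"
    hence s0: "s2 = \<zero>" "s3 = \<zero>" and a1: "a2 = \<one>" "a3 = \<one>"
      using 2(1,3) 3(1,3) by auto
    have "k = \<one>" using coeffs(2) R kR s(1,4) s0 a1 by simp
    hence "a1 = a4" using coeffs(3) R a1 by simp
    thus ?thesis using s(1,4) s0 a1 by auto
  next
    assume s: "s1 \<noteq> \<one>" "s2 = \<one>" "s3 = \<one>" "s4 \<noteq> \<one>"
    hence s0: "s1 = \<zero>" "s4 = \<zero>" and a1: "a1 = \<one>" "a4 = \<one>"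
      using 1(1,3) 4(1,3) by auto
    have "k = \<one>" using coeffs(2) R kR s(2,3) s0 a1 by simp
    hence "a2 = a3" using coeffs(3) R a1 by simp
    thus ?thesis using s(2,3) s0 a1 by auto
  next
    assume s: "s1 \<noteq> \<one>" "s2 = \<one>" "s3 \<noteq> \<one>" "s4 = \<one>"
    hence s0: "s1 = \<zero>" "s3 = \<zero>" and a1: "a1 = \<one>" "a3 = \<one>"
      using 1(1,3) 3(1,3) by auto
    have "k = \<one>" using coeffs(2) R kR s(2,4) s0 a1 by simp
    hence "a2 = a4" using coeffs(3) R a1 by simp
    thus ?thesis using s(2,4) s0 a1 by auto
  qed (use 1(1,3) 2(1,3) 3(1,3) 4(1,3) coeffs R kR k0 in simp)+
  hence "(\<lambda>(s, a). s \<otimes> \<theta> \<oplus> a) ` {(s1, a1), (s2, a2)} = (\<lambda>(s, a). s \<otimes> \<theta> \<oplus> a) ` {(s3, a3), (s4, a4)}"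
    by (rule arg_cong)
  thus ?thesis by (simp add: 1(4) 2(4) 3(4) 4(4))
qed

text \<open>The number \<open>Q\<close> is the index of the nonzero elements of \<open>F\<close> in
  the multiplicative group, so logarithms modulo \<open>Q\<close> determine elements up to a factor
  from \<open>F\<close>. Congruent sums of logarithms thus mean products that agree up to such a
  factor.\<close>

lemma exists_sidon_mod:
  assumes fin: "finite (carrier R)" and F: "subfield F R" and \<theta>: "\<theta> \<in> carrier R"
    and indep: "independent F (exp_base \<theta> 3)" and span: "Span F (exp_base \<theta> 3) = carrier R"
    and Q: "Q = card F ^ 2 + card F + 1"
  shows "\<exists>D \<subseteq> {0..<int Q}. card D = card F + 1 \<and> sidon_mod (int Q) D"
proof -
  have FR: "F \<subseteq> carrier R" using subfieldE(3)[OF F] .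
  have finF: "finite F" using FR fin finite_subset by blast
  have zero_one: "\<zero> \<in> F" "\<one> \<in> F"
    using subringE(2,3)[OF subfieldE(1)[OF F]] by auto
  define V where "V = insert \<one> ((\<lambda>a. \<theta> \<oplus> a) ` F)"
  have card3: "card (carrier R) = card F ^ 3"
    using card_Span_independent[OF F finF indep] unfolding span by (simp add: exp_base_def)
  \<comment> \<open>In effect \<open>\<theta>\<close> is not in \<open>F\<close>. This keeps zero
    out of \<open>V\<close> and separates \<open>\<one>\<close> from the elements
    \<open>\<theta> \<oplus> a\<close>.\<close>
  have \<theta>F: False if a: "a \<in> F" "b \<in> F" "\<theta> \<oplus> a = b" for a b
  proof -
    have "\<zero> \<otimes> (\<theta> \<otimes> \<theta>) \<oplus> \<one> \<otimes> \<theta> \<oplus> a = \<zero> \<otimes> (\<theta> \<otimes> \<theta>) \<oplus> \<zero> \<otimes> \<theta> \<oplus> b"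
      using a FR \<theta> by auto
    from quadratic_coeffs_eq(2)[OF F \<theta> indep _ _ _ _ _ _ this] show False
      using zero_one a(1,2) by simp
  qed
  have V: "V \<subseteq> carrier R - {\<zero>}"
    using \<theta> FR \<theta>F zero_one by (auto simp: V_def)
  have "\<one> \<notin> (\<lambda>a. \<theta> \<oplus> a) ` F" using \<theta>F zero_one by force
  moreover have "inj_on (\<lambda>a. \<theta> \<oplus> a) F"
    using FR \<theta> by (intro inj_onI) (simp add: subset_iff)
  ultimately have card_V: "card V = card F + 1"
    using finF by (simp add: V_def card_image)
  obtain g where g: "g \<in> carrier R - {\<zero>}" and gen: "carrier R - {\<zero>} = {g [^] i | i :: nat. i \<in> UNIV}"
    using finite_field_mult_group_has_gen[OF fin] by auto
  have "\<exists>i :: nat. u = g [^] i" if "u \<in> V" for u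
    using that V gen by blast
  then obtain L :: "'a \<Rightarrow> nat" where L: "\<And>u. u \<in> V \<Longrightarrow> u = g [^] L u" by metis
  have N: "card F ^ 3 - 1 = Q * (card F - 1)"
    by (cases "card F") (simp_all add: Q power2_eq_square power3_eq_cube algebra_simps)
  \<comment> \<open>Raising to the power \<open>card F - 1\<close> gives a power of
    \<open>g [^] (card (carrier R) - 1)\<close>, which is one.\<close>
  have kernel: "g [^] (Q * j) \<in> F" for j :: nat
  proof (rule mem_subfield_if_pow_eq_one[OF fin F])
    have "(g [^] (Q * j)) [^] (card F - 1) = (g [^] (card (carrier R) - 1)) [^] j"
      using g by (simp add: nat_pow_pow card3 N[simplified] mult_ac)
    also have "g [^] (card (carrier R) - 1) = \<one>"
      using pow_card_subfield_eq_one[OF carrier_is_subfield fin g] .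
    finally show "(g [^] (Q * j)) [^] (card F - 1) = \<one>" by simp
  qed (use g in simp)
  \<comment> \<open>Logarithms are natural numbers, so the ordering assumption makes their
    difference a natural multiple of \<open>Q\<close>. Symmetry removes it in
    \<open>log\<close>.\<close>
  have log_le: "{u, v} = {w, z}"
    if uvwz: "u \<in> V" "v \<in> V" "w \<in> V" "z \<in> V"
      and cong: "[L u + L v = L w + L z] (mod Q)" and le: "L w + L z \<le> L u + L v" for u v w z
  proof -
    obtain j where j: "L u + L v = Q * j + (L w + L z)"
      using cong le by (metis cong_le_nat add.commute mult.commute)
    have mem: "g [^] L x = x" if "x \<in> V" for x using L that by simp
    have "u \<otimes> v = g [^] (L u + L v)"
      using g uvwz by (simp add: nat_pow_mult[symmetric] mem)
    also have "\<dots> = g [^] (Q * j) \<otimes> (w \<otimes> z)"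
      using g uvwz by (simp add: j nat_pow_mult[symmetric] mem)
    finally have "u \<otimes> v = g [^] (Q * j) \<otimes> (w \<otimes> z)" .
    moreover have "g [^] (Q * j) \<noteq> \<zero>" using g gen by blast
    ultimately show ?thesis
      using product_of_linear_factors_unique[OF F \<theta> indep V_def uvwz kernel] by blast
  qed
  have log: "{u, v} = {w, z}"
    if "u \<in> V" "v \<in> V" "w \<in> V" "z \<in> V" "[L u + L v = L w + L z] (mod Q)" for u v w z
    using log_le[of u v w z] log_le[of w z u v] that by (metis cong_sym nat_le_linear)
  define l where "l = (\<lambda>u. int (L u mod Q))"
  have l_sum: "[L u + L v = L w + L z] (mod Q)" if "[l u + l v = l w + l z] (mod int Q)" for u v w z
  proof -
    have "[int (L u + L v) = l u + l v] (mod int Q)" for u v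
      by (simp add: l_def cong_def zmod_int mod_simps)
    hence "[int (L u + L v) = int (L w + L z)] (mod int Q)"
      using that by (meson cong_sym cong_trans)
    thus ?thesis by (simp only: cong_int_iff)
  qed
  have "inj_on l V"
  proof (rule inj_onI)
    fix u v assume "u \<in> V" "v \<in> V" "l u = l v"
    \<comment> \<open>Injectivity is the case of two doubles.\<close>
    hence "{u, u} = {v, v}" by (intro log l_sum) auto
    thus "u = v" by simp
  qed
  hence "card (l ` V) = card F + 1" by (simp add: card_image card_V)
  moreover have "sidon_mod (int Q) (l ` V)"
    unfolding sidon_mod_def
  proof clarify
    fix u v w z assume "u \<in> V" "v \<in> V" "w \<in> V" "z \<in> V" "[l u + l v = l w + l z] (mod int Q)"
    hence "{u, v} = {w, z}" by (intro log l_sum)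
    from arg_cong[OF this, of "image l"] show "{l u, l v} = {l w, l z}" by simp
  qed
  moreover have "Q > 0" using Q by simp
  hence "l ` V \<subseteq> {0..<int Q}" by (auto simp: l_def)
  ultimately show ?thesis by blast
qed

end


section \<open>The field of order p^3 and the lift to twice the modulus\<close>

text \<open>The cubic extension is the quotient of the polynomial ring over the residues modulo
  \<open>p\<close> by a cubic without roots; \<open>\<theta>\<close> is the class of
  \<open>X\<close>, and \<open>F\<close> is the image of the constants.\<close>

lemma exists_singer_sidon_mod:
  assumes "prime p" and Q: "Q = p ^ 2 + p + 1"
  shows "\<exists>D \<subseteq> {0..<int Q}. card D = p + 1 \<and> sidon_mod (int Q) D"
proof -
  define R where "R = residue_ring (int p)"
  interpret residues_prime p R by unfold_locales (use assms R_def in auto)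
  interpret field R by (rule is_field)
  obtain a b c where abc: "a \<in> carrier R" "b \<in> carrier R" "c \<in> carrier R"
    and no_root: "\<And>r. r \<in> carrier R \<Longrightarrow> r \<otimes>\<^bsub>R\<^esub> r \<otimes>\<^bsub>R\<^esub> r \<oplus>\<^bsub>R\<^esub> a \<otimes>\<^bsub>R\<^esub> (r \<otimes>\<^bsub>R\<^esub> r) \<oplus>\<^bsub>R\<^esub> b \<otimes>\<^bsub>R\<^esub> r \<oplus>\<^bsub>R\<^esub> c \<noteq> \<zero>\<^bsub>R\<^esub>"
    using exists_cubic_without_root[OF finite] by blast
  define P where "P = [\<one>\<^bsub>R\<^esub>, a, b, c]"
  have P: "P \<in> carrier (poly_ring R)" "pirreducible\<^bsub>R\<^esub> (carrier R) P" "degree P = 3"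
    using pirreducible_cubic[OF abc no_root] by (auto simp: P_def)
  define E where "E = Rupt\<^bsub>R\<^esub> (carrier R) P"
  define h where "h = rupture_surj (carrier R) P"
  define F where "F = h ` poly_of_const ` carrier R"
  interpret E: field E
    unfolding E_def using rupture_is_field_iff_pirreducible[OF carrier_is_subfield P(1)] P(2) by simp
  interpret Hom: ring_hom_ring "poly_ring R" E h
    unfolding h_def E_def using rupture_surj_hom(2)[OF carrier_is_subring P(1)] .
  have F: "subfield F E"
    unfolding F_def
    using Hom.img_is_subfield(2)[OF univ_poly_subfield_of_consts[OF carrier_is_subfield] E.one_not_zero] .
  have X: "h X\<^bsub>R\<^esub> \<in> carrier E" using var_closed(1)[OF carrier_is_subring] by simp
  have base: "E.independent F (E.exp_base (h X\<^bsub>R\<^esub>) 3)" "E.Span F (E.exp_base (h X\<^bsub>R\<^esub>) 3) = carrier E"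
    using rupture_exp_base[OF carrier_is_subfield P(1,2)] unfolding P(3) E_def F_def h_def by simp_all
  have card_F: "card F = p"
  proof -
    have "inj_on h (poly_of_const ` carrier R)"
      using Hom.img_is_subfield(1)[OF univ_poly_subfield_of_consts[OF carrier_is_subfield] E.one_not_zero] .
    moreover have "inj_on poly_of_const (carrier R)"
      by (auto intro!: inj_onI simp: poly_of_const_def split: if_splits)
    ultimately show ?thesis by (simp add: F_def card_image res_carrier_eq)
  qed
  hence QF: "Q = card F ^ 2 + card F + 1" using Q by simp
  have "finite F" unfolding F_def by simp
  \<comment> \<open>Infinite sets have cardinality 0, so the positive value \<open>p ^ 3\<close>
    shows finiteness.\<close>
  have "finite (carrier E)"
    using E.card_Span_independent[OF F \<open>finite F\<close> base(1)] card_F prime_gt_0_nat[OF \<open>prime p\<close>]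
    unfolding base(2) by (intro card_ge_0_finite) (simp add: E.exp_base_def)
  from E.exists_sidon_mod[OF this F X base QF] show ?thesis
    unfolding card_F .
qed

theorem theorem1p3:
  fixes p m :: nat
  assumes "prime p"
    and "m = 2 * (p ^ 2 + p + 1)"
  shows "\<exists>A \<subseteq> carrier (integer_mod_group m).
    (\<forall>n \<in> carrier (integer_mod_group m). rep_count (integer_mod_group m) A n \<le> 4) \<and>
    real (card {n \<in> carrier (integer_mod_group m). rep_count (integer_mod_group m) A n = 4})
      = 1 / 2 * real m - 1"
proof -
  define q where "q = p ^ 2 + p + 1"
  have q: "q > 0" "m = 2 * q" using assms(2) by (auto simp: q_def)
  obtain D where D: "D \<subseteq> {0..<int q}" "card D = p + 1" "sidon_mod (int q) D"
    using exists_singer_sidon_mod[OF assms(1) q_def] by blast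
  define A where "A = {a \<in> {0..<2 * int q}. a mod int q \<in> D}"
  have carrier: "carrier (integer_mod_group m) = {0..<2 * int q}"
    using q by (simp add: carrier_integer_mod_group)
  have rep: "rep_count (integer_mod_group m) A n = 2 * rep_mod (int q) D (n mod int q)"
    if "n \<in> {0..<2 * int q}" for n
    using rep_count_lift[OF q(1) D(1) that] by (simp add: q(2) A_def)
  \<comment> \<open>Since counts double under the lift, 4 representations modulo \<open>m\<close>
    correspond to 2 modulo \<open>q\<close>.\<close>
  have "{n \<in> carrier (integer_mod_group m). rep_count (integer_mod_group m) A n = 4}
      = {n \<in> {0..<2 * int q}. rep_mod (int q) D (n mod int q) = 2}"
    using rep by (auto simp: carrier)
  hence "card {n \<in> carrier (integer_mod_group m). rep_count (integer_mod_group m) A n = 4}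
      = 2 * ((p + 1) choose 2)"
    using card_periodic_double[of "int q" "\<lambda>n. rep_mod (int q) D n = 2"]
      card_rep_mod_eq_2[OF D(1,3)] q(1) D(2) by simp
  \<comment> \<open>This number is \<open>q - 1\<close>, which is half of \<open>m\<close> less
    one.\<close>
  also have "\<dots> = p * (p + 1)"
    by (simp add: choose_two)
  finally have "real (card {n \<in> carrier (integer_mod_group m). rep_count (integer_mod_group m) A n = 4})
      = 1 / 2 * real m - 1"
    by (simp add: q(2) q_def power2_eq_square algebra_simps)
  moreover have "\<forall>n \<in> carrier (integer_mod_group m). rep_count (integer_mod_group m) A n \<le> 4"
    using rep rep_mod_le_2[OF D(1,3)] by (fastforce simp: carrier)
  moreover have "A \<subseteq> carrier (integer_mod_group m)" by (auto simp: A_def carrier)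
  ultimately show ?thesis by blast
qed

end
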